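(* Let $(M^{2n+1},\theta,\xi,\eta,g)$ be a nearly cosymplectic manifold. Then $$\sum_{i=1}^{2n+1}\sum_{j=1}^{2n}g\big([R(E_i,\xi),\theta]F_j,(\bar\nabla_{E_i}J)(F_j)\big)=0,$$ where $\{F_i\}_{i=1,\dots,2n}$ is an orthonormal basis of $\mathcal F$ and $\{E_i\}_{i=1,\dots,2n+1}=\{F_i\}_{i=1,\dots,2n}\cup\{\xi\}$.
   Context: An almost contact (metric) structure on a Riemannian manifold $(M^{2n+1},g)$ consists of a $(1,1)$-tensor $\theta$, a 1-form $\eta$ and a unit vector field $\xi$ with $\theta^2=-\mathrm{Id}+\eta\otimes\xi$, $\eta(\xi)=1$, compatible with the metric: $g(\theta X,\theta Y)=g(X,Y)-\eta(X)\eta(Y)$ (so $\eta=g(\xi,\cdot)$, $\theta\xi=0$ and $\theta$ is skew-symmetric). It is nearly cosymplectic, and $(M,\theta,\xi,\eta,g)$ is a nearly cosymplectic manifold, if $(\nabla_X\theta)(Y)+(\nabla_Y\theta)(X)=0$ for all $X,Y$, where $\nabla$ is the Levi-Civita connection of $g$. $\mathcal F$ is the distribution orthogonal to $\xi$ (rank $2n$), $J$ is the restriction of $\theta$ to $\mathcal F$, and $\bar\nabla$ is the connection on $\mathcal F$ obtained by projecting $\nabla$ orthogonally onto $\mathcal F$; $(\bar\nabla_XJ)(Y)=\bar\nabla_X(JY)-J\bar\nabla_XY$ for $X\in TM$ and $Y$ a section of $\mathcal F$. The curvature is $R(X,Y)=[\nabla_X,\nabla_Y]-\nabla_{[X,Y]}$,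 and $[R(X,Y),\theta]=R(X,Y)\circ\theta-\theta\circ R(X,Y)$. *)

theory Defs
  imports "HOL-Analysis.Analysis" "HOL-Library.Function_Algebras"
begin

section \<open>Smooth manifolds\<close>

primrec Ck_on :: "nat \<Rightarrow> 'b::real_normed_vector set \<Rightarrow> ('b \<Rightarrow> 'c::real_normed_vector) \<Rightarrow> bool" where
  "Ck_on 0 S f = continuous_on S f"
| "Ck_on (Suc k) S f =
    ((\<forall>x\<in>S. f differentiable (at x)) \<and> (\<forall>v. Ck_on k S (\<lambda>x. frechet_derivative f (at x) v)))"

text \<open>Only used for open \<open>S\<close> in a finite-dimensional space.\<close>
definition smooth_on :: "'b::real_normed_vector set \<Rightarrow> ('b \<Rightarrow> 'c::real_normed_vector) \<Rightarrow> bool" where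
  "smooth_on S f \<longleftrightarrow> (\<forall>k. Ck_on k S f)"

text \<open>The manifold is the whole type \<open>'a\<close>; Hausdorffness and second countability are
  imposed by type classes. A chart is a pair of its domain and its coordinate map, and the dimension
  is \<open>CARD('m)\<close>. The coordinate map is only meaningful on the domain.\<close>

type_synonym ('a, 'm) chart = "'a set \<times> ('a \<Rightarrow> real ^ 'm)"

definition smooth_atlas ::
  "('a::{t2_space,second_countable_topology}, 'm::finite) chart set \<Rightarrow> bool" where
  "smooth_atlas A \<longleftrightarrow>
     (\<Union>(U, \<phi>)\<in>A. U) = UNIV \<and>
     (\<forall>(U, \<phi>)\<in>A. open U \<and> open (\<phi> ` U) \<and> homeomorphism U (\<phi> ` U) \<phi> (inv_into U \<phi>)) \<and>
     (\<forall>(U, \<phi>)\<in>A. \<forall>(V, \<psi>)\<in>A. smooth_on (\<phi> ` (U \<inter> V)) (\<psi> \<circ> inv_into U \<phi>))"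

definition smooth_functions ::
  "('a::{t2_space,second_countable_topology}, 'm::finite) chart set \<Rightarrow> ('a \<Rightarrow> real) set" where
  "smooth_functions A = {f. \<forall>(U, \<phi>)\<in>A. smooth_on (\<phi> ` U) (f \<circ> inv_into U \<phi>)}"


section \<open>Tangent vectors and vector fields\<close>

text \<open>A tangent vector at \<open>p\<close> is a derivation at \<open>p\<close> of the algebra of smooth functions; it is
  extended by \<open>0\<close> to the non-smooth functions, so that equality of functionals is
  equality of tangent vectors. Vectors and vector fields are added and subtracted pointwise.\<close>

type_synonym 'a tvec = "('a \<Rightarrow> real) \<Rightarrow> real"
type_synonym 'a vfield = "'a \<Rightarrow> 'a tvec"

definition tscale :: "real \<Rightarrow> 'a tvec \<Rightarrow> 'a tvec"  (infixr "*\<^sub>t" 75) where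
  "c *\<^sub>t v = (\<lambda>f. c * v f)"

global_interpretation tvec: vector_space "tscale :: real \<Rightarrow> 'a tvec \<Rightarrow> 'a tvec"
  by unfold_locales (auto simp: tscale_def fun_eq_iff algebra_simps)

definition fscale :: "('a \<Rightarrow> real) \<Rightarrow> 'a vfield \<Rightarrow> 'a vfield"  (infixr "*\<^sub>f" 75) where
  "f *\<^sub>f X = (\<lambda>p. f p *\<^sub>t X p)"

definition tangent_space ::
  "('a::{t2_space,second_countable_topology}, 'm::finite) chart set \<Rightarrow> 'a \<Rightarrow> 'a tvec set" where
  "tangent_space A p = {v.
     (\<forall>f\<in>smooth_functions A. \<forall>h\<in>smooth_functions A. \<forall>a b.
        v (\<lambda>q. a * f q + b * h q) = a * v f + b * v h) \<and>
     (\<forall>f\<in>smooth_functions A. \<forall>h\<in>smooth_functions A.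
        v (\<lambda>q. f q * h q) = v f * h p + f p * v h) \<and>
     (\<forall>f. f \<notin> smooth_functions A \<longrightarrow> v f = 0)}"

definition dir_deriv :: "'a vfield \<Rightarrow> ('a \<Rightarrow> real) \<Rightarrow> ('a \<Rightarrow> real)" where
  "dir_deriv X f = (\<lambda>p. X p f)"

definition vfields ::
  "('a::{t2_space,second_countable_topology}, 'm::finite) chart set \<Rightarrow> 'a vfield set" where
  "vfields A = {X. (\<forall>p. X p \<in> tangent_space A p) \<and>
                   (\<forall>f\<in>smooth_functions A. dir_deriv X f \<in> smooth_functions A)}"

text \<open>The case distinction keeps the bracket \<open>0\<close> on non-smooth functions.\<close>
definition lie_bracket ::
  "('a::{t2_space,second_countable_topology}, 'm::finite) chart set \<Rightarrow>
   'a vfield \<Rightarrow> 'a vfield \<Rightarrow> 'a vfield" where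
  "lie_bracket A X Y = (\<lambda>p f. if f \<in> smooth_functions A
     then X p (dir_deriv Y f) - Y p (dir_deriv X f) else 0)"


section \<open>Tensor fields\<close>

type_synonym 'a one_form = "'a \<Rightarrow> 'a tvec \<Rightarrow> real"
type_synonym 'a bilinear_form = "'a \<Rightarrow> 'a tvec \<Rightarrow> 'a tvec \<Rightarrow> real"
type_synonym 'a endo = "'a \<Rightarrow> 'a tvec \<Rightarrow> 'a tvec"

definition app_form :: "'a one_form \<Rightarrow> 'a vfield \<Rightarrow> 'a \<Rightarrow> real" where
  "app_form \<eta> X = (\<lambda>p. \<eta> p (X p))"

definition app_bilinear :: "'a bilinear_form \<Rightarrow> 'a vfield \<Rightarrow> 'a vfield \<Rightarrow> 'a \<Rightarrow> real" where
  "app_bilinear g X Y = (\<lambda>p. g p (X p) (Y p))"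

definition app_endo :: "'a endo \<Rightarrow> 'a vfield \<Rightarrow> 'a vfield"  (infixr "\<cdot>" 80) where
  "T \<cdot> X = (\<lambda>p. T p (X p))"

definition smooth_one_form ::
  "('a::{t2_space,second_countable_topology}, 'm::finite) chart set \<Rightarrow> 'a one_form \<Rightarrow> bool" where
  "smooth_one_form A \<eta> \<longleftrightarrow>
     (\<forall>p. \<forall>u\<in>tangent_space A p. \<forall>v\<in>tangent_space A p. \<forall>a b.
        \<eta> p (a *\<^sub>t u + b *\<^sub>t v) = a * \<eta> p u + b * \<eta> p v) \<and>
     (\<forall>X\<in>vfields A. app_form \<eta> X \<in> smooth_functions A)"

definition smooth_endo ::
  "('a::{t2_space,second_countable_topology}, 'm::finite) chart set \<Rightarrow> 'a endo \<Rightarrow> bool" where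
  "smooth_endo A \<theta> \<longleftrightarrow>
     (\<forall>p. \<forall>u\<in>tangent_space A p. \<theta> p u \<in> tangent_space A p) \<and>
     (\<forall>p. \<forall>u\<in>tangent_space A p. \<forall>v\<in>tangent_space A p. \<forall>a b.
        \<theta> p (a *\<^sub>t u + b *\<^sub>t v) = a *\<^sub>t \<theta> p u + b *\<^sub>t \<theta> p v) \<and>
     (\<forall>X\<in>vfields A. \<theta> \<cdot> X \<in> vfields A)"

definition riemannian_metric ::
  "('a::{t2_space,second_countable_topology}, 'm::finite) chart set \<Rightarrow> 'a bilinear_form \<Rightarrow> bool" where
  "riemannian_metric A g \<longleftrightarrow>
     (\<forall>p. \<forall>u\<in>tangent_space A p. \<forall>v\<in>tangent_space A p. \<forall>w\<in>tangent_space A p. \<forall>a b.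
        g p (a *\<^sub>t u + b *\<^sub>t v) w = a * g p u w + b * g p v w) \<and>
     (\<forall>p. \<forall>u\<in>tangent_space A p. \<forall>v\<in>tangent_space A p. g p u v = g p v u) \<and>
     (\<forall>p. \<forall>u\<in>tangent_space A p. u \<noteq> 0 \<longrightarrow> g p u u > 0) \<and>
     (\<forall>X\<in>vfields A. \<forall>Y\<in>vfields A. app_bilinear g X Y \<in> smooth_functions A)"


section \<open>Connections and curvature\<close>

type_synonym 'a connection = "'a vfield \<Rightarrow> 'a vfield \<Rightarrow> 'a vfield"

definition affine_connection ::
  "('a::{t2_space,second_countable_topology}, 'm::finite) chart set \<Rightarrow> 'a connection \<Rightarrow> bool" where
  "affine_connection A D \<longleftrightarrow>
     (\<forall>X\<in>vfields A. \<forall>Y\<in>vfields A. D X Y \<in> vfields A) \<and>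
     (\<forall>X\<in>vfields A. \<forall>Y\<in>vfields A. \<forall>Z\<in>vfields A.
        D (X + Y) Z = D X Z + D Y Z \<and> D X (Y + Z) = D X Y + D X Z) \<and>
     (\<forall>f\<in>smooth_functions A. \<forall>X\<in>vfields A. \<forall>Y\<in>vfields A.
        D (f *\<^sub>f X) Y = f *\<^sub>f D X Y \<and> D X (f *\<^sub>f Y) = dir_deriv X f *\<^sub>f Y + f *\<^sub>f D X Y)"

definition levi_civita ::
  "('a::{t2_space,second_countable_topology}, 'm::finite) chart set \<Rightarrow>
   'a bilinear_form \<Rightarrow> 'a connection \<Rightarrow> bool" where
  "levi_civita A g D \<longleftrightarrow> affine_connection A D \<and>
     (\<forall>X\<in>vfields A. \<forall>Y\<in>vfields A. D X Y - D Y X = lie_bracket A X Y) \<and>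
     (\<forall>X\<in>vfields A. \<forall>Y\<in>vfields A. \<forall>Z\<in>vfields A.
        dir_deriv X (app_bilinear g Y Z) = app_bilinear g (D X Y) Z + app_bilinear g Y (D X Z))"

definition curvature ::
  "('a::{t2_space,second_countable_topology}, 'm::finite) chart set \<Rightarrow> 'a connection \<Rightarrow>
   'a vfield \<Rightarrow> 'a vfield \<Rightarrow> 'a vfield \<Rightarrow> 'a vfield" where
  "curvature A D X Y Z = D X (D Y Z) - D Y (D X Z) - D (lie_bracket A X Y) Z"

definition curvature_commutator ::
  "('a::{t2_space,second_countable_topology}, 'm::finite) chart set \<Rightarrow> 'a connection \<Rightarrow> 'a endo \<Rightarrow>
   'a vfield \<Rightarrow> 'a vfield \<Rightarrow> 'a vfield \<Rightarrow> 'a vfield" where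
  "curvature_commutator A D \<theta> X Y Z = curvature A D X Y (\<theta> \<cdot> Z) - \<theta> \<cdot> curvature A D X Y Z"

definition cov_deriv_endo :: "'a connection \<Rightarrow> 'a endo \<Rightarrow> 'a vfield \<Rightarrow> 'a vfield \<Rightarrow> 'a vfield" where
  "cov_deriv_endo D T X Y = D X (T \<cdot> Y) - T \<cdot> D X Y"


section \<open>Nearly cosymplectic manifolds\<close>

definition almost_contact_metric ::
  "('a::{t2_space,second_countable_topology}, 'm::finite) chart set \<Rightarrow>
   'a endo \<Rightarrow> 'a vfield \<Rightarrow> 'a one_form \<Rightarrow> 'a bilinear_form \<Rightarrow> bool" where
  "almost_contact_metric A \<theta> \<xi> \<eta> g \<longleftrightarrow>
     smooth_endo A \<theta> \<and> \<xi> \<in> vfields A \<and> smooth_one_form A \<eta> \<and> riemannian_metric A g \<and>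
     (\<forall>p. g p (\<xi> p) (\<xi> p) = 1) \<and>
     (\<forall>p. \<eta> p (\<xi> p) = 1) \<and>
     (\<forall>p. \<forall>u\<in>tangent_space A p. \<theta> p (\<theta> p u) = - u + \<eta> p u *\<^sub>t \<xi> p) \<and>
     (\<forall>p. \<forall>u\<in>tangent_space A p. \<forall>v\<in>tangent_space A p.
        g p (\<theta> p u) (\<theta> p v) = g p u v - \<eta> p u * \<eta> p v)"

definition nearly_cosymplectic ::
  "('a::{t2_space,second_countable_topology}, 'm::finite) chart set \<Rightarrow>
   'a endo \<Rightarrow> 'a vfield \<Rightarrow> 'a one_form \<Rightarrow> 'a bilinear_form \<Rightarrow> 'a connection \<Rightarrow> bool" where
  "nearly_cosymplectic A \<theta> \<xi> \<eta> g D \<longleftrightarrow>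
     almost_contact_metric A \<theta> \<xi> \<eta> g \<and> levi_civita A g D \<and>
     (\<forall>X\<in>vfields A. \<forall>Y\<in>vfields A. cov_deriv_endo D \<theta> X Y + cov_deriv_endo D \<theta> Y X = 0)"

definition contact_distr ::
  "('a::{t2_space,second_countable_topology}, 'm::finite) chart set \<Rightarrow>
   'a bilinear_form \<Rightarrow> 'a vfield \<Rightarrow> 'a \<Rightarrow> 'a tvec set" where
  "contact_distr A g \<xi> p = {v \<in> tangent_space A p. g p v (\<xi> p) = 0}"

definition distr_sections ::
  "('a::{t2_space,second_countable_topology}, 'm::finite) chart set \<Rightarrow>
   'a bilinear_form \<Rightarrow> 'a vfield \<Rightarrow> 'a vfield set" where
  "distr_sections A g \<xi> = {Y \<in> vfields A. \<forall>p. Y p \<in> contact_distr A g \<xi> p}"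

definition J_endo ::
  "('a::{t2_space,second_countable_topology}, 'm::finite) chart set \<Rightarrow>
   'a endo \<Rightarrow> 'a vfield \<Rightarrow> 'a bilinear_form \<Rightarrow> 'a endo" where
  "J_endo A \<theta> \<xi> g = (\<lambda>p. restrict (\<theta> p) (contact_distr A g \<xi> p))"

text \<open>Orthogonal projection onto the orthogonal complement of the unit field \<open>\<xi>\<close>.\<close>
definition distr_proj :: "'a bilinear_form \<Rightarrow> 'a vfield \<Rightarrow> 'a endo" where
  "distr_proj g \<xi> = (\<lambda>p v. v - g p v (\<xi> p) *\<^sub>t \<xi> p)"

definition distr_connection :: "'a bilinear_form \<Rightarrow> 'a vfield \<Rightarrow> 'a connection \<Rightarrow> 'a connection" where
  "distr_connection g \<xi> D = (\<lambda>X Y. distr_proj g \<xi> \<cdot> D X Y)"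

definition orthonormal_basis ::
  "('a tvec \<Rightarrow> 'a tvec \<Rightarrow> real) \<Rightarrow> 'a tvec set \<Rightarrow> 'i set \<Rightarrow> ('i \<Rightarrow> 'a tvec) \<Rightarrow> bool" where
  "orthonormal_basis B W I e \<longleftrightarrow>
     (\<forall>i\<in>I. \<forall>j\<in>I. B (e i) (e j) = (if i = j then 1 else 0)) \<and> tvec.span (e ` I) = W"

end

theory Submission
  imports Defs
begin

text \<open>
  Put \<open>T(X,Y,Z) = g((\<nabla>\<^sub>X \<theta>) Y, Z)\<close> and \<open>\<rho>(X,Y,Z) = g(R(X,\<xi>) Y, Z)\<close>. The nearly cosymplectic condition
  and the skew symmetry of \<open>\<theta>\<close> make \<open>T\<close> totally skew. On sections of the distribution
  \<open>\<theta>\<^sup>2 = -1\<close>, which gives \<open>T(X,\<theta>Y,Z) = T(X,Y,\<theta>Z)\<close>, so \<open>U(X,Y,Z) = T(X,\<theta>Y,Z)\<close> is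
  again totally skew. Moving \<open>\<theta>\<close> from \<open>\<rho>\<close> to \<open>T\<close> turns the sum into \<open>- 2 \<Sum> \<rho> U\<close>. This vanishes
  because the cyclic sum of \<open>\<rho>\<close> is zero by the pair symmetry of the curvature and the first Bianchi identity.
  The terms with \<open>E\<^sub>i = \<xi>\<close> vanish since \<open>R(\<xi>,\<xi>) = 0\<close>.
\<close>

section \<open>Linear structure on smooth functions and vector fields\<close>

text \<open>Since \<open>S\<close> is open, a derivative at a point of \<open>S\<close> depends only
  on the values on \<open>S\<close>, so agreement there passes to every order.\<close>

lemma Ck_on_cong:
  assumes "open S" and "\<And>x. x \<in> S \<Longrightarrow> f x = h x" and "Ck_on k S f"
  shows "Ck_on k S h"
  using assms(2,3)
proof (induction k arbitrary: f h)
  case 0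
  then show ?case using continuous_on_cong[of S S f h] by simp
next
  case (Suc k)
  have df: "f differentiable (at x)" if "x \<in> S" for x
    using Suc.prems(2) that by simp
  have "h differentiable (at x)" if "x \<in> S" for x
    using df[OF that] Suc.prems(1) assms(1) that
    by (meson differentiable_def has_derivative_transform_within_open)
  moreover have "frechet_derivative f (at x) v = frechet_derivative h (at x) v" if "x \<in> S" for x v
    using frechet_derivative_transform_within_open[OF df[OF that] assms(1) that] Suc.prems(1)
    by metis
  then have "Ck_on k S (\<lambda>x. frechet_derivative h (at x) v)" for v
    using Suc.IH Suc.prems(2) by (metis (no_types, lifting) Ck_on.simps(2))
  ultimately show ?case by simp
qed

lemma Ck_on_lincomb:
  assumes "open S" and "Ck_on k S f" and "Ck_on k S h"
  shows "Ck_on k S (\<lambda>x. a *\<^sub>R f x + b *\<^sub>R h x)"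
  using assms(2,3)
proof (induction k arbitrary: f h)
  case 0
  then show ?case by (auto intro!: continuous_intros)
next
  case (Suc k)
  have deriv: "((\<lambda>x. a *\<^sub>R f x + b *\<^sub>R h x) has_derivative
      (\<lambda>v. a *\<^sub>R frechet_derivative f (at x) v + b *\<^sub>R frechet_derivative h (at x) v)) (at x)"
    if "x \<in> S" for x
    using Suc.prems that
    by (auto intro!: derivative_intros simp: frechet_derivative_works[symmetric])
  have "Ck_on k S (\<lambda>x. frechet_derivative (\<lambda>x. a *\<^sub>R f x + b *\<^sub>R h x) (at x) v)" for v
  \<comment> \<open>The formula for the derivative of the combination is known only at points of
    \<open>S\<close>, so equality on \<open>S\<close> has to suffice.\<close>
  proof (rule Ck_on_cong[OF assms(1)])
    show "Ck_on k S (\<lambda>x. a *\<^sub>R frechet_derivative f (at x) v + b *\<^sub>R frechet_derivative h (at x) v)"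
      using Suc by simp
  qed (simp add: frechet_derivative_at[OF deriv, symmetric])
  then show ?case using deriv by (auto simp: differentiable_def)
qed

lemma smooth_functions_lincomb:
  assumes "smooth_atlas A" and "f \<in> smooth_functions A" and "h \<in> smooth_functions A"
  shows "(\<lambda>p. a * f p + b * h p) \<in> smooth_functions A"
proof -
  have "smooth_on (\<phi> ` U) ((\<lambda>p. a * f p + b * h p) \<circ> inv_into U \<phi>)" if "(U, \<phi>) \<in> A" for U \<phi>
  proof -
    have "open (\<phi> ` U)" using assms(1) that unfolding smooth_atlas_def by auto
    moreover have "smooth_on (\<phi> ` U) (f \<circ> inv_into U \<phi>)" "smooth_on (\<phi> ` U) (h \<circ> inv_into U \<phi>)"
      using assms(2,3) that unfolding smooth_functions_def by auto
    ultimately show ?thesis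
      using Ck_on_lincomb[of "\<phi> ` U" _ "f \<circ> inv_into U \<phi>" "h \<circ> inv_into U \<phi>" a b]
      by (simp add: smooth_on_def o_def)
  qed
  then show ?thesis unfolding smooth_functions_def by auto
qed

lemma subspace_tangent_space: "tvec.subspace (tangent_space A p)"
  unfolding tvec.subspace_def tangent_space_def
  by (auto simp: tscale_def algebra_simps)

lemmas tangent_space_add = tvec.subspace_add[OF subspace_tangent_space]
  and tangent_space_diff = tvec.subspace_diff[OF subspace_tangent_space]
  and tangent_space_scale = tvec.subspace_scale[OF subspace_tangent_space]
  and tangent_space_sum = tvec.subspace_sum[OF subspace_tangent_space]

lemma vfields_tangent: "X \<in> vfields A \<Longrightarrow> X p \<in> tangent_space A p"
  by (simp add: vfields_def)

lemma tangent_space_lincomb: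
  assumes "v \<in> tangent_space A p" and "f \<in> smooth_functions A" and "h \<in> smooth_functions A"
  shows "v (\<lambda>q. a * f q + b * h q) = a * v f + b * v h"
  using assms by (simp add: tangent_space_def)

lemma dir_deriv_smooth:
  "X \<in> vfields A \<Longrightarrow> f \<in> smooth_functions A \<Longrightarrow> dir_deriv X f \<in> smooth_functions A"
  by (simp add: vfields_def)

section \<open>Lie bracket of vector fields and the Jacobi identity\<close>

locale manifold =
  fixes A :: "('a::{t2_space,second_countable_topology}, 'm::finite) chart set"
  assumes atlas: "smooth_atlas A"
begin

lemma smooth_diff:
  "f \<in> smooth_functions A \<Longrightarrow> h \<in> smooth_functions A \<Longrightarrow> (\<lambda>p. f p - h p) \<in> smooth_functions A"
  using smooth_functions_lincomb[OF atlas, of f h 1 "-1"] by simp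

lemma tangent_diff_fun:
  "v \<in> tangent_space A p \<Longrightarrow> f \<in> smooth_functions A \<Longrightarrow> h \<in> smooth_functions A \<Longrightarrow>
    v (\<lambda>q. f q - h q) = v f - v h"
  using tangent_space_lincomb[of v A p f h 1 "-1"] by simp

lemma tangent_add_fun:
  "v \<in> tangent_space A p \<Longrightarrow> f \<in> smooth_functions A \<Longrightarrow> h \<in> smooth_functions A \<Longrightarrow>
    v (\<lambda>q. f q + h q) = v f + v h"
  using tangent_space_lincomb[of v A p f h 1 1] by simp

lemma vfields_diff: "X \<in> vfields A \<Longrightarrow> Y \<in> vfields A \<Longrightarrow> X - Y \<in> vfields A"
  using smooth_diff by (auto simp: vfields_def dir_deriv_def intro: tangent_space_diff)

lemma dir_deriv_lie_bracket:
  "f \<in> smooth_functions A \<Longrightarrow>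
    dir_deriv (lie_bracket A X Y) f = (\<lambda>p. X p (dir_deriv Y f) - Y p (dir_deriv X f))"
  by (simp add: dir_deriv_def lie_bracket_def)

lemma lie_bracket_self: "lie_bracket A X X = 0"
  by (auto simp: lie_bracket_def fun_eq_iff)

lemma lie_bracket_flip: "lie_bracket A Y X = - lie_bracket A X Y"
  by (auto simp: lie_bracket_def fun_eq_iff)

text \<open>A tangent vector is linear only on smooth functions, so splitting the difference rests
  on the smoothness of both second derivatives of \<open>f\<close>.\<close>

lemma dir_deriv_lie_bracket_at:
  assumes "X \<in> vfields A" "Y \<in> vfields A" "Z \<in> vfields A" "f \<in> smooth_functions A"
  shows "X p (dir_deriv (lie_bracket A Y Z) f) =
    X p (dir_deriv Y (dir_deriv Z f)) - X p (dir_deriv Z (dir_deriv Y f))"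
  using tangent_diff_fun[OF vfields_tangent[OF assms(1)]
      dir_deriv_smooth[OF assms(2) dir_deriv_smooth[OF assms(3,4)]]
      dir_deriv_smooth[OF assms(3) dir_deriv_smooth[OF assms(2,4)]], of p]
  unfolding dir_deriv_lie_bracket[OF assms(4)] by (simp add: dir_deriv_def)

text \<open>On a smooth \<open>f\<close> each double bracket gives four third-order terms, and the
  twelve terms cancel in pairs. On any other function every bracket is \<open>0\<close> by
  definition.\<close>

lemma jacobi:
  assumes "X \<in> vfields A" "Y \<in> vfields A" "Z \<in> vfields A"
  shows "lie_bracket A X (lie_bracket A Y Z) + lie_bracket A Y (lie_bracket A Z X)
    + lie_bracket A Z (lie_bracket A X Y) = 0"
proof (intro ext)
  fix p f
  show "(lie_bracket A X (lie_bracket A Y Z) + lie_bracket A Y (lie_bracket A Z X)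
    + lie_bracket A Z (lie_bracket A X Y)) p f = (0 :: 'a vfield) p f"
  proof (cases "f \<in> smooth_functions A")
    case True
    have br: "lie_bracket A V W p (dir_deriv U f) =
        V p (dir_deriv W (dir_deriv U f)) - W p (dir_deriv V (dir_deriv U f))"
      if "U \<in> vfields A" for U V W
      using dir_deriv_smooth[OF that True] by (simp add: lie_bracket_def)
    show ?thesis
      using True assms
      by (simp add: lie_bracket_def[of _ X "lie_bracket A Y Z"] lie_bracket_def[of _ Y "lie_bracket A Z X"]
          lie_bracket_def[of _ Z "lie_bracket A X Y"] dir_deriv_lie_bracket_at br)
  qed (simp add: lie_bracket_def)
qed

end

section \<open>Curvature identities of the Levi-Civita connection\<close>

locale riemannian_manifold = manifold A
  for A :: "('a::{t2_space,second_countable_topology}, 'm::finite) chart set" +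
  fixes g :: "'a bilinear_form" and D :: "'a connection"
  assumes metric: "riemannian_metric A g" and lc: "levi_civita A g D"
begin

section \<open>Algebra of the metric at a point\<close>

lemma metric_lincomb:
  "\<lbrakk>u \<in> tangent_space A p; v \<in> tangent_space A p; w \<in> tangent_space A p\<rbrakk> \<Longrightarrow>
    g p (a *\<^sub>t u + b *\<^sub>t v) w = a * g p u w + b * g p v w"
  using metric unfolding riemannian_metric_def by blast

lemma metric_sym:
  "\<lbrakk>u \<in> tangent_space A p; v \<in> tangent_space A p\<rbrakk> \<Longrightarrow> g p u v = g p v u"
  using metric unfolding riemannian_metric_def by blast

lemma metric_definite:
  "u \<in> tangent_space A p \<Longrightarrow> g p u u = 0 \<Longrightarrow> u = 0"
  using metric unfolding riemannian_metric_def by (metis less_irrefl)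

lemma metric_smooth:
  "X \<in> vfields A \<Longrightarrow> Y \<in> vfields A \<Longrightarrow> app_bilinear g X Y \<in> smooth_functions A"
  using metric unfolding riemannian_metric_def by blast

lemma metric_add_left:
  "\<lbrakk>u \<in> tangent_space A p; v \<in> tangent_space A p; w \<in> tangent_space A p\<rbrakk> \<Longrightarrow>
    g p (u + v) w = g p u w + g p v w"
  using metric_lincomb[of u p v w 1 1] by simp

lemma metric_diff_left:
  "\<lbrakk>u \<in> tangent_space A p; v \<in> tangent_space A p; w \<in> tangent_space A p\<rbrakk> \<Longrightarrow>
    g p (u - v) w = g p u w - g p v w"
  using metric_lincomb[of u p v w 1 "-1"] by simp

lemma metric_scale_left:
  "\<lbrakk>u \<in> tangent_space A p; w \<in> tangent_space A p\<rbrakk> \<Longrightarrow> g p (a *\<^sub>t u) w = a * g p u w"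
  using metric_lincomb[of u p u w a 0] by simp

lemma metric_zero_left: "w \<in> tangent_space A p \<Longrightarrow> g p 0 w = 0"
  using metric_scale_left[of w p w 0] by simp

lemma metric_zero_right: "u \<in> tangent_space A p \<Longrightarrow> g p u 0 = 0"
  using metric_zero_left metric_sym tvec.subspace_0[OF subspace_tangent_space] by metis

lemma metric_minus_left:
  "\<lbrakk>u \<in> tangent_space A p; w \<in> tangent_space A p\<rbrakk> \<Longrightarrow> g p (- u) w = - g p u w"
  using metric_scale_left[of u p w "-1"] by simp

lemma metric_sum_left:
  assumes "\<And>i. i \<in> I \<Longrightarrow> v i \<in> tangent_space A p" "w \<in> tangent_space A p"
  shows "g p (\<Sum>i\<in>I. c i *\<^sub>t v i) w = (\<Sum>i\<in>I. c i * g p (v i) w)"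
  using assms(1)
proof (induction I rule: infinite_finite_induct)
  case (insert i I)
  have "(\<Sum>i\<in>I. c i *\<^sub>t v i) \<in> tangent_space A p"
    using insert.prems by (intro tangent_space_sum tangent_space_scale) auto
  then have "g p (c i *\<^sub>t v i + (\<Sum>i\<in>I. c i *\<^sub>t v i)) w = c i * g p (v i) w + g p (\<Sum>i\<in>I. c i *\<^sub>t v i) w"
    using insert.prems assms(2) by (simp only: metric_add_left metric_scale_left tangent_space_scale insertI1)
  moreover have "g p (\<Sum>i\<in>I. c i *\<^sub>t v i) w = (\<Sum>i\<in>I. c i * g p (v i) w)"
    using insert.IH insert.prems by blast
  ultimately show ?case
    unfolding sum.insert[OF insert.hyps] by (rule trans[OF _ arg_cong])
qed (auto simp: metric_zero_left assms)

lemma metric_sum_right: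
  assumes "\<And>i. i \<in> I \<Longrightarrow> v i \<in> tangent_space A p" "w \<in> tangent_space A p"
  shows "g p w (\<Sum>i\<in>I. c i *\<^sub>t v i) = (\<Sum>i\<in>I. c i * g p w (v i))"
proof -
  have "(\<Sum>i\<in>I. c i *\<^sub>t v i) \<in> tangent_space A p"
    using assms by (intro tangent_space_sum tangent_space_scale) auto
  then have "g p w (\<Sum>i\<in>I. c i *\<^sub>t v i) = (\<Sum>i\<in>I. c i * g p (v i) w)"
    using metric_sym[of w p "\<Sum>i\<in>I. c i *\<^sub>t v i"] metric_sum_left[OF assms] assms by simp
  then show ?thesis using metric_sym assms by simp
qed

section \<open>Calculus of the Levi-Civita connection\<close>

lemma D_vfields: "X \<in> vfields A \<Longrightarrow> Y \<in> vfields A \<Longrightarrow> D X Y \<in> vfields A"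
  using lc unfolding levi_civita_def affine_connection_def by blast

lemma D_add_left:
  "\<lbrakk>X \<in> vfields A; Y \<in> vfields A; Z \<in> vfields A\<rbrakk> \<Longrightarrow> D (X + Y) Z = D X Z + D Y Z"
  using lc unfolding levi_civita_def affine_connection_def by blast

lemma D_add_right:
  "\<lbrakk>X \<in> vfields A; Y \<in> vfields A; Z \<in> vfields A\<rbrakk> \<Longrightarrow> D X (Y + Z) = D X Y + D X Z"
  using lc unfolding levi_civita_def affine_connection_def by blast

lemma D_diff_left:
  "\<lbrakk>X \<in> vfields A; Y \<in> vfields A; Z \<in> vfields A\<rbrakk> \<Longrightarrow> D (X - Y) Z = D X Z - D Y Z"
  using D_add_left[of "X - Y" Y Z] vfields_diff by simp

lemma D_diff_right:
  "\<lbrakk>X \<in> vfields A; Y \<in> vfields A; Z \<in> vfields A\<rbrakk> \<Longrightarrow> D X (Y - Z) = D X Y - D X Z"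
  using D_add_right[of X "Y - Z" Z] vfields_diff by simp

lemma D_zero_left: "Z \<in> vfields A \<Longrightarrow> D 0 Z = 0"
  using D_diff_left[of Z Z Z] by simp

text \<open>Additivity is enough: \<open>- Y\<close> is treated as \<open>(Y - Y) - Y\<close>, so no
  constant has to be pulled out of \<open>D\<close>.\<close>

lemma D_minus_right: "X \<in> vfields A \<Longrightarrow> Y \<in> vfields A \<Longrightarrow> D X (- Y) = - D X Y"
  using D_diff_right[of X "Y - Y" Y] D_diff_right[of X Y Y] vfields_diff[of Y Y] by simp

lemma D_minus_left: "X \<in> vfields A \<Longrightarrow> Y \<in> vfields A \<Longrightarrow> D (- X) Y = - D X Y"
  using D_diff_left[of "X - X" X Y] D_diff_left[of X X Y] vfields_diff[of X X] by simp

lemma torsion_free: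
  "X \<in> vfields A \<Longrightarrow> Y \<in> vfields A \<Longrightarrow> lie_bracket A X Y = D X Y - D Y X"
  using lc unfolding levi_civita_def by simp

lemma lie_bracket_vfields:
  "X \<in> vfields A \<Longrightarrow> Y \<in> vfields A \<Longrightarrow> lie_bracket A X Y \<in> vfields A"
  by (simp add: torsion_free vfields_diff D_vfields)

lemma metric_compat:
  assumes "X \<in> vfields A" "Y \<in> vfields A" "Z \<in> vfields A"
  shows "X p (app_bilinear g Y Z) = g p (D X Y p) (Z p) + g p (Y p) (D X Z p)"
proof -
  have "dir_deriv X (app_bilinear g Y Z) = app_bilinear g (D X Y) Z + app_bilinear g Y (D X Z)"
    using lc assms unfolding levi_civita_def by simp
  from fun_cong[OF this, of p] show ?thesis by (simp add: dir_deriv_def app_bilinear_def)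
qed

section \<open>Symmetries of the curvature\<close>

lemma curvature_vfields:
  "\<lbrakk>X \<in> vfields A; Y \<in> vfields A; Z \<in> vfields A\<rbrakk> \<Longrightarrow> curvature A D X Y Z \<in> vfields A"
  by (simp add: curvature_def vfields_diff D_vfields lie_bracket_vfields)

lemma curvature_self: "X \<in> vfields A \<Longrightarrow> Z \<in> vfields A \<Longrightarrow> curvature A D X X Z = 0"
  by (simp add: curvature_def lie_bracket_self D_zero_left)

lemma curvature_skew12:
  "\<lbrakk>X \<in> vfields A; Y \<in> vfields A; Z \<in> vfields A\<rbrakk> \<Longrightarrow> curvature A D Y X Z = - curvature A D X Y Z"
  using D_minus_left[OF lie_bracket_vfields[of X Y], of Z]
  by (simp add: curvature_def lie_bracket_flip[of X Y])

text \<open>Regrouped by the outermost derivative, the cyclic sum becomes, by two uses of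
  torsion-freeness, the cyclic sum of double brackets, which is the Jacobi identity.\<close>

lemma bianchi:
  assumes "X \<in> vfields A" "Y \<in> vfields A" "Z \<in> vfields A"
  shows "curvature A D X Y Z + curvature A D Y Z X + curvature A D Z X Y = 0"
proof -
  have br: "D U (D V W) - D U (D W V) - D (lie_bracket A V W) U = lie_bracket A U (lie_bracket A V W)"
    if "U \<in> vfields A" "V \<in> vfields A" "W \<in> vfields A" for U V W
  proof -
    have "D U (lie_bracket A V W) = D U (D V W) - D U (D W V)"
      using that by (simp add: torsion_free[of V W] D_diff_right D_vfields)
    then show ?thesis
      using torsion_free[OF that(1) lie_bracket_vfields[OF that(2,3)]] by simp
  qed
  have "curvature A D X Y Z + curvature A D Y Z X + curvature A D Z X Y =
     (D X (D Y Z) - D X (D Z Y) - D (lie_bracket A Y Z) X)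
   + (D Y (D Z X) - D Y (D X Z) - D (lie_bracket A Z X) Y)
   + (D Z (D X Y) - D Z (D Y X) - D (lie_bracket A X Y) Z)"
    by (simp add: curvature_def)
  then show ?thesis using jacobi assms by (simp add: br)
qed

text \<open>The function \<open>g(Z,W)\<close> is differentiated along
  \<open>lie_bracket A X Y\<close> in two ways: directly, and as a commutator of second
  derivatives.\<close>

lemma curvature_skew34:
  assumes X: "X \<in> vfields A" and Y: "Y \<in> vfields A" and Z: "Z \<in> vfields A" and W: "W \<in> vfields A"
  shows "g p (curvature A D X Y Z p) (W p) = - g p (curvature A D X Y W p) (Z p)"
proof -
  have second: "U p (dir_deriv V (app_bilinear g Z W)) =
      g p (D U (D V Z) p) (W p) + g p (D V Z p) (D U W p)
      + g p (D U Z p) (D V W p) + g p (Z p) (D U (D V W) p)"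
    if U: "U \<in> vfields A" and V: "V \<in> vfields A" for U V
  proof -
    have "dir_deriv V (app_bilinear g Z W) =
        (\<lambda>q. app_bilinear g (D V Z) W q + app_bilinear g Z (D V W) q)"
      using metric_compat[OF V Z W] by (auto simp: dir_deriv_def app_bilinear_def)
    then show ?thesis
      using tangent_add_fun[OF vfields_tangent[OF U, of p], of "app_bilinear g (D V Z) W"
          "app_bilinear g Z (D V W)"]
        metric_compat[OF U D_vfields[OF V Z] W, of p] metric_compat[OF U Z D_vfields[OF V W], of p]
        metric_smooth D_vfields Z W V
      by simp
  qed
  let ?L = "lie_bracket A X Y"
  have L: "?L \<in> vfields A" using lie_bracket_vfields X Y by simp
  have "g p (D ?L Z p) (W p) + g p (Z p) (D ?L W p) = ?L p (app_bilinear g Z W)"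
    using metric_compat[OF L Z W] by simp
  also have "\<dots> = X p (dir_deriv Y (app_bilinear g Z W)) - Y p (dir_deriv X (app_bilinear g Z W))"
    using metric_smooth[OF Z W] by (simp add: lie_bracket_def)
  \<comment> \<open>The mixed terms in \<open>second\<close> are exchanged when \<open>U\<close> and
    \<open>V\<close> are, so they cancel in the commutator.\<close>
  finally have eq: "g p (D ?L Z p) (W p) + g p (Z p) (D ?L W p) =
      g p (D X (D Y Z) p) (W p) + g p (Z p) (D X (D Y W) p)
      - g p (D Y (D X Z) p) (W p) - g p (Z p) (D Y (D X W) p)"
    using second[OF X Y] second[OF Y X] by simp
  have expand: "g p (curvature A D X Y U p) (V p) =
      g p (D X (D Y U) p) (V p) - g p (D Y (D X U) p) (V p) - g p (D ?L U p) (V p)"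
    if "U \<in> vfields A" "V \<in> vfields A" for U V
    using that X Y L
    by (simp add: curvature_def metric_diff_left D_vfields vfields_tangent
        tangent_space_diff)
  have sym: "g p (Z p) (V p) = g p (V p) (Z p)" if "V \<in> vfields A" for V
    using metric_sym vfields_tangent that Z by blast
  show ?thesis
    using eq expand[OF Z W] expand[OF W Z]
    by (simp add: sym D_vfields X Y W L)
qed

lemma curvature_pair_sym:
  assumes "X \<in> vfields A" "Y \<in> vfields A" "Z \<in> vfields A" "W \<in> vfields A"
  shows "g p (curvature A D X Y Z p) (W p) = g p (curvature A D Z W X p) (Y p)"
proof -
  define R where "R X Y Z W = g p (curvature A D X Y Z p) (W p)" for X Y Z W
  have s34: "R X Y Z W = - R X Y W Z"
    if "X \<in> vfields A" "Y \<in> vfields A" "Z \<in> vfields A" "W \<in> vfields A" for X Y Z W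
    using curvature_skew34[OF that] by (simp add: R_def)
  have s12: "R X Y Z W = - R Y X Z W"
    if "X \<in> vfields A" "Y \<in> vfields A" "Z \<in> vfields A" "W \<in> vfields A" for X Y Z W
    using curvature_skew12[OF that(2,1,3)] that
    by (simp add: R_def metric_minus_left vfields_tangent curvature_vfields)
  have b: "R X Y Z W + R Y Z X W + R Z X Y W = 0"
    if "X \<in> vfields A" "Y \<in> vfields A" "Z \<in> vfields A" "W \<in> vfields A" for X Y Z W
  proof -
    have "g p ((curvature A D X Y Z + curvature A D Y Z X + curvature A D Z X Y) p) (W p) = 0"
      using bianchi[OF that(1-3)] metric_zero_left[OF vfields_tangent[OF that(4)]] by simp
    then show ?thesis
      using that by (simp add: R_def metric_add_left vfields_tangent curvature_vfields
          tangent_space_add)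
  qed
  note v = assms
  \<comment> \<open>The four Bianchi identities have \<open>W\<close>, \<open>X\<close>,
    \<open>Y\<close>, \<open>Z\<close> in turn as last argument. With signs \<open>+ + - -\<close>
    and the skew symmetries they add up to \<open>2 * (R X Y Z W - R Z W X Y) = 0\<close>.\<close>
  have "R X Y Z W = R Z W X Y"
    using b[OF v(1,2,3,4)] b[OF v(2,3,4,1)] b[OF v(3,4,1,2)] b[OF v(4,1,2,3)]
      s34[OF v(1,2,3,4)] s34[OF v(2,3,1,4)] s34[OF v(3,4,1,2)] s34[OF v(4,1,2,3)]
      s12[OF v(3,1,2,4)] s34[OF v(1,3,2,4)] s12[OF v(4,2,3,1)] s34[OF v(2,4,3,1)]
    by linarith
  then show ?thesis by (simp add: R_def)
qed

text \<open>Pair symmetry carries the fixed field \<open>W\<close> from the second slot to the last,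
  where the first Bianchi identity applies. It will be used with \<open>W\<close> equal to
  \<xi>.\<close>

lemma curvature_cyclic:
  assumes "X \<in> vfields A" "Y \<in> vfields A" "Z \<in> vfields A" "W \<in> vfields A"
  shows "g p (curvature A D X W Y p) (Z p) + g p (curvature A D Y W Z p) (X p)
    + g p (curvature A D Z W X p) (Y p) = 0"
proof -
  have "g p ((curvature A D X Y Z + curvature A D Y Z X + curvature A D Z X Y) p) (W p) = 0"
    using bianchi[OF assms(1-3)] metric_zero_left[OF vfields_tangent[OF assms(4)]] by simp
  then show ?thesis
    using assms curvature_pair_sym[of X W Y Z p] curvature_pair_sym[of Y W Z X p]
      curvature_pair_sym[of Z W X Y p]
    by (simp add: metric_add_left vfields_tangent curvature_vfields
        tangent_space_add)
qed

end

section \<open>Nearly cosymplectic structures\<close>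

lemma sum_cyclic:
  fixes f :: "'i \<Rightarrow> 'i \<Rightarrow> 'i \<Rightarrow> 'b::comm_monoid_add"
  shows "(\<Sum>i\<in>I. \<Sum>j\<in>I. \<Sum>k\<in>I. f j k i) = (\<Sum>i\<in>I. \<Sum>j\<in>I. \<Sum>k\<in>I. f i j k)"
proof -
  have "(\<Sum>i\<in>I. \<Sum>j\<in>I. \<Sum>k\<in>I. f j k i) = (\<Sum>j\<in>I. \<Sum>i\<in>I. \<Sum>k\<in>I. f j k i)"
    by (rule sum.swap)
  also have "\<dots> = (\<Sum>j\<in>I. \<Sum>k\<in>I. \<Sum>i\<in>I. f j k i)"
    by (intro sum.cong refl sum.swap)
  finally show ?thesis .
qed

text \<open>Rotating the indices does not change the total. In the sum of the three rotations
  \<open>u\<close> factors out and leaves the cyclic sum of \<rho>, so three times the total is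
  zero.\<close>

lemma sum_Bianchi_alternating:
  fixes \<rho> u :: "'i \<Rightarrow> 'i \<Rightarrow> 'i \<Rightarrow> real"
  assumes "\<And>i j k. \<lbrakk>i \<in> I; j \<in> I; k \<in> I\<rbrakk> \<Longrightarrow> \<rho> i j k + \<rho> j k i + \<rho> k i j = 0"
    and "\<And>i j k. \<lbrakk>i \<in> I; j \<in> I; k \<in> I\<rbrakk> \<Longrightarrow> u j k i = u i j k"
  shows "(\<Sum>i\<in>I. \<Sum>j\<in>I. \<Sum>k\<in>I. \<rho> i j k * u i j k) = 0"
proof -
  let ?s = "\<lambda>f. \<Sum>i\<in>I. \<Sum>j\<in>I. \<Sum>k\<in>I. (f i j k :: real)"
  let ?f = "\<lambda>i j k. \<rho> i j k * u i j k"
  have "?s ?f + ?s (\<lambda>i j k. ?f j k i) + ?s (\<lambda>i j k. ?f k i j) =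
      ?s (\<lambda>i j k. ?f i j k + ?f j k i + ?f k i j)"
    by (simp add: sum.distrib)
  also have "\<dots> = 0"
  proof (intro sum.neutral ballI)
    fix i j k assume "i \<in> I" "j \<in> I" "k \<in> I"
    then have "u j k i = u i j k" "u k i j = u i j k" "\<rho> i j k + \<rho> j k i + \<rho> k i j = 0"
      using assms by metis+
    then show "?f i j k + ?f j k i + ?f k i j = 0"
      by (metis distrib_right mult_zero_left)
  qed
  finally show ?thesis
    using sum_cyclic[of ?f I] sum_cyclic[of "\<lambda>i j k. ?f j k i" I] by simp
qed

locale nearly_cosymplectic_manifold = riemannian_manifold A g D
  for A :: "('a::{t2_space,second_countable_topology}, 'm::finite) chart set"
    and g :: "'a bilinear_form" and D :: "'a connection" +
  fixes \<theta> :: "'a endo" and \<xi> :: "'a vfield" and \<eta> :: "'a one_form"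
  assumes nc: "nearly_cosymplectic A \<theta> \<xi> \<eta> g D"
begin

section \<open>Pointwise algebra of the almost contact metric structure\<close>

lemma acm: "almost_contact_metric A \<theta> \<xi> \<eta> g"
  using nc by (simp add: nearly_cosymplectic_def)

lemma \<xi>_vfields: "\<xi> \<in> vfields A"
  using acm by (simp add: almost_contact_metric_def)

lemmas \<xi>_tangent = vfields_tangent[OF \<xi>_vfields]

lemma \<xi>_unit: "g p (\<xi> p) (\<xi> p) = 1" and \<eta>_\<xi>: "\<eta> p (\<xi> p) = 1"
  using acm by (simp_all add: almost_contact_metric_def)

lemma \<theta>_\<theta>: "u \<in> tangent_space A p \<Longrightarrow> \<theta> p (\<theta> p u) = - u + \<eta> p u *\<^sub>t \<xi> p"
  using acm by (simp add: almost_contact_metric_def)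

lemma \<theta>_metric:
  "u \<in> tangent_space A p \<Longrightarrow> v \<in> tangent_space A p \<Longrightarrow>
    g p (\<theta> p u) (\<theta> p v) = g p u v - \<eta> p u * \<eta> p v"
  using acm by (simp add: almost_contact_metric_def)

lemma \<theta>_smooth: "smooth_endo A \<theta>"
  using acm by (simp add: almost_contact_metric_def)

lemma \<theta>_tangent: "u \<in> tangent_space A p \<Longrightarrow> \<theta> p u \<in> tangent_space A p"
  using \<theta>_smooth unfolding smooth_endo_def by blast

lemma \<theta>_vfields: "X \<in> vfields A \<Longrightarrow> \<theta> \<cdot> X \<in> vfields A"
  using \<theta>_smooth unfolding smooth_endo_def by blast

lemma \<theta>_lincomb:
  "u \<in> tangent_space A p \<Longrightarrow> v \<in> tangent_space A p \<Longrightarrow>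
    \<theta> p (a *\<^sub>t u + b *\<^sub>t v) = a *\<^sub>t \<theta> p u + b *\<^sub>t \<theta> p v"
  using \<theta>_smooth unfolding smooth_endo_def by blast

text \<open>Compatibility gives \<theta>\<xi> squared length \<open>1 - 1 = 0\<close>, and the
  metric is definite.\<close>

lemma \<theta>_\<xi>: "\<theta> p (\<xi> p) = 0"
  using metric_definite[OF \<theta>_tangent[OF \<xi>_tangent[of p]]] \<theta>_metric[OF \<xi>_tangent \<xi>_tangent, of p]
  by (simp add: \<xi>_unit \<eta>_\<xi>)

lemma \<eta>_eq: "u \<in> tangent_space A p \<Longrightarrow> \<eta> p u = g p u (\<xi> p)"
  using \<theta>_metric[OF _ \<xi>_tangent, of u p] \<theta>_tangent
  by (simp add: \<theta>_\<xi> metric_zero_right \<eta>_\<xi>)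

text \<open>The cube of \<theta> is computed in two ways, as \<theta> after its square and as its
  square after \<theta>; they differ by
  \<open>\<eta> p (\<theta> p u) *\<^sub>t \<xi> p\<close>.\<close>

lemma \<eta>_\<theta>:
  assumes u: "u \<in> tangent_space A p"
  shows "\<eta> p (\<theta> p u) = 0"
proof -
  have "\<theta> p (\<theta> p (\<theta> p u)) = \<theta> p ((-1) *\<^sub>t u + \<eta> p u *\<^sub>t \<xi> p)"
    using \<theta>_\<theta>[OF u] by simp
  also have "\<dots> = - \<theta> p u"
    using \<theta>_lincomb[OF u \<xi>_tangent, of "-1" "\<eta> p u"] by (simp add: \<theta>_\<xi>)
  finally have "\<eta> p (\<theta> p u) *\<^sub>t \<xi> p = 0"
    using \<theta>_\<theta>[OF \<theta>_tangent[OF u]] by simp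
  then show ?thesis
    using metric_scale_left[OF \<xi>_tangent \<xi>_tangent, of p "\<eta> p (\<theta> p u)"] metric_zero_left[OF \<xi>_tangent, of p]
    by (metis \<xi>_unit mult.right_neutral)
qed

lemma \<theta>_orthogonal: "u \<in> tangent_space A p \<Longrightarrow> g p (\<theta> p u) (\<xi> p) = 0"
  using \<eta>_\<theta> \<eta>_eq \<theta>_tangent by metis

text \<open>This is compatibility for \<open>\<theta> p u\<close> and \<open>v\<close>, with the
  \<xi>-terms removed by \<open>\<eta>_\<theta>\<close> and
  \<open>\<theta>_orthogonal\<close>.\<close>

lemma \<theta>_skew:
  assumes u: "u \<in> tangent_space A p" and v: "v \<in> tangent_space A p"
  shows "g p (\<theta> p u) v = - g p u (\<theta> p v)"
proof -
  have "g p (\<theta> p u) v = g p ((-1) *\<^sub>t u + \<eta> p u *\<^sub>t \<xi> p) (\<theta> p v)"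
    using \<theta>_metric[OF \<theta>_tangent[OF u] v] \<theta>_\<theta>[OF u] \<eta>_\<theta>[OF u] by simp
  also have "\<dots> = - g p u (\<theta> p v) + \<eta> p u * g p (\<theta> p v) (\<xi> p)"
    using metric_lincomb[OF u \<xi>_tangent \<theta>_tangent[OF v], of "-1" "\<eta> p u"]
      metric_sym[OF \<xi>_tangent \<theta>_tangent[OF v]] by simp
  finally show ?thesis using \<theta>_orthogonal[OF v] by simp
qed

section \<open>The covariant derivative of \<theta> as a form in three vector fields\<close>

lemma \<theta>_cov_vfields:
  "X \<in> vfields A \<Longrightarrow> Y \<in> vfields A \<Longrightarrow> cov_deriv_endo D \<theta> X Y \<in> vfields A"
  by (simp add: cov_deriv_endo_def vfields_diff D_vfields \<theta>_vfields)

definition T :: "'a \<Rightarrow> 'a vfield \<Rightarrow> 'a vfield \<Rightarrow> 'a vfield \<Rightarrow> real" where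
  "T p X Y Z = g p (cov_deriv_endo D \<theta> X Y p) (Z p)"

text \<open>Skewness moves \<theta> off the derivative of \<open>Y\<close>. Both later symmetries of
  \<open>T\<close> in its last two slots are read off from this form.\<close>

lemma T_expand:
  assumes "X \<in> vfields A" "Y \<in> vfields A" "Z \<in> vfields A"
  shows "T p X Y Z = g p (D X (\<theta> \<cdot> Y) p) (Z p) + g p (D X Y p) (\<theta> p (Z p))"
proof -
  have "T p X Y Z = g p (D X (\<theta> \<cdot> Y) p) (Z p) - g p (\<theta> p (D X Y p)) (Z p)"
    using assms by (simp add: T_def cov_deriv_endo_def app_endo_def[of \<theta> "D X Y"]
        metric_diff_left vfields_tangent D_vfields \<theta>_vfields \<theta>_tangent)
  then show ?thesis using \<theta>_skew assms by (simp add: vfields_tangent D_vfields)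
qed

lemma T_skew12:
  assumes "X \<in> vfields A" "Y \<in> vfields A" "Z \<in> vfields A"
  shows "T p Y X Z = - T p X Y Z"
proof -
  have "cov_deriv_endo D \<theta> X Y + cov_deriv_endo D \<theta> Y X = 0"
    using nc assms by (simp add: nearly_cosymplectic_def)
  then have "g p ((cov_deriv_endo D \<theta> X Y + cov_deriv_endo D \<theta> Y X) p) (Z p) = 0"
    using assms by (simp add: metric_zero_left vfields_tangent)
  then show ?thesis
    using assms by (simp add: T_def metric_add_left vfields_tangent \<theta>_cov_vfields)
qed

text \<open>The skewness of \<theta> is inherited by its covariant derivative: differentiate
  g(\<theta>Y, Z) = - g(Y, \<theta>Z) along \<open>X\<close>.\<close>

lemma T_skew23:
  assumes X: "X \<in> vfields A" and Y: "Y \<in> vfields A" and Z: "Z \<in> vfields A"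
  shows "T p X Z Y = - T p X Y Z"
proof -
  \<comment> \<open>The minus sign is spelled as a linear combination to match the linearity clause
    for tangent vectors.\<close>
  have "app_bilinear g (\<theta> \<cdot> Y) Z =
      (\<lambda>q. 0 * app_bilinear g Y (\<theta> \<cdot> Z) q + (-1) * app_bilinear g Y (\<theta> \<cdot> Z) q)"
    using \<theta>_skew Y Z by (auto simp: app_bilinear_def app_endo_def vfields_tangent)
  then have "X p (app_bilinear g (\<theta> \<cdot> Y) Z) = - X p (app_bilinear g Y (\<theta> \<cdot> Z))"
    using tangent_space_lincomb[OF vfields_tangent[OF X, of p]
        metric_smooth[OF Y \<theta>_vfields[OF Z]] metric_smooth[OF Y \<theta>_vfields[OF Z]], of 0 "-1"]
    by simp
  then have *: "g p (D X (\<theta> \<cdot> Y) p) (Z p) + g p (\<theta> p (Y p)) (D X Z p)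
      = - g p (D X Y p) (\<theta> p (Z p)) - g p (Y p) (D X (\<theta> \<cdot> Z) p)"
    using metric_compat[OF X \<theta>_vfields[OF Y] Z, of p] metric_compat[OF X Y \<theta>_vfields[OF Z], of p]
    by (simp add: app_endo_def)
  have "g p (\<theta> p (Y p)) (D X Z p) = g p (D X Z p) (\<theta> p (Y p))"
      "g p (Y p) (D X (\<theta> \<cdot> Z) p) = g p (D X (\<theta> \<cdot> Z) p) (Y p)"
    using metric_sym assms by (simp_all add: vfields_tangent D_vfields \<theta>_vfields \<theta>_tangent)
  then show ?thesis
    using * T_expand[OF X Y Z] T_expand[OF X Z Y] by simp
qed

section \<open>Sections of the distribution and the induced connection\<close>

lemma distr_sectionsD:
  assumes "Y \<in> distr_sections A g \<xi>"
  shows "Y \<in> vfields A" and "Y p \<in> tangent_space A p" and "g p (Y p) (\<xi> p) = 0"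
    and "Y p \<in> contact_distr A g \<xi> p"
  using assms by (auto simp: distr_sections_def contact_distr_def)

lemma \<theta>_\<theta>_section:
  assumes "Y \<in> distr_sections A g \<xi>"
  shows "\<theta> \<cdot> \<theta> \<cdot> Y = - Y"
  using \<theta>_\<theta> \<eta>_eq distr_sectionsD[OF assms] by (auto simp: app_endo_def fun_eq_iff tscale_def)

text \<open>Expanded by \<open>T_expand\<close>, both sides are g(D X (\<theta>Y), \<theta>Z) - g(D
  X Y, Z). The square of \<theta> on \<open>Y\<close> is needed as an identity of fields, because it
  is differentiated; on \<open>Z\<close> only its value at \<open>p\<close> enters.\<close>

lemma T_\<theta>:
  assumes X: "X \<in> vfields A" and Y: "Y \<in> distr_sections A g \<xi>" and Z: "Z \<in> distr_sections A g \<xi>"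
  shows "T p X (\<theta> \<cdot> Y) Z = T p X Y (\<theta> \<cdot> Z)"
proof -
  note Y' = distr_sectionsD[OF Y] and Z' = distr_sectionsD[OF Z]
  have "\<theta> p (\<theta> p (Z p)) = - Z p"
    using \<theta>_\<theta>_section[OF Z] by (auto simp: app_endo_def dest: fun_cong)
  moreover have "g p (D X Y p) (- Z p) = - g p (D X Y p) (Z p)"
    using metric_sym metric_minus_left tvec.subspace_neg[OF subspace_tangent_space]
      vfields_tangent[OF D_vfields[OF X Y'(1)]] Z'(2) by metis
  ultimately show ?thesis
    using T_expand[OF X \<theta>_vfields[OF Y'(1)] Z'(1)] T_expand[OF X Y'(1) \<theta>_vfields[OF Z'(1)]]
    by (simp add: \<theta>_\<theta>_section[OF Y] D_minus_right X Y' Z' metric_minus_left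
        vfields_tangent[OF D_vfields[OF X Y'(1)]] app_endo_def[of \<theta> Z])
qed

text \<open>Two transpositions turn T(Y, \<theta>Z, X) into T(X, Y, \<theta>Z), and
  \<open>T_\<theta>\<close> moves \<theta> to the middle. This is the invariance that
  \<open>sum_Bianchi_alternating\<close> asks of \<open>u\<close>.\<close>

lemma T_\<theta>_cyclic:
  assumes X: "X \<in> distr_sections A g \<xi>" and Y: "Y \<in> distr_sections A g \<xi>"
    and Z: "Z \<in> distr_sections A g \<xi>"
  shows "T p Y (\<theta> \<cdot> Z) X = T p X (\<theta> \<cdot> Y) Z"
proof -
  note v = distr_sectionsD(1)[OF X] distr_sectionsD(1)[OF Y] distr_sectionsD(1)[OF Z]
  have "T p Y (\<theta> \<cdot> Z) X = T p X Y (\<theta> \<cdot> Z)"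
    using T_skew12[OF v(1,2) \<theta>_vfields[OF v(3)]] T_skew23[OF v(2) \<theta>_vfields[OF v(3)] v(1)]
    by simp
  then show ?thesis using T_\<theta>[OF v(1) Y Z] by simp
qed

text \<open>Projection changes a derivative only by a multiple of \<xi>, which is orthogonal to
  \<open>Z\<close> and killed by \<theta>. The field \<open>X\<close> is arbitrary, so \<xi> itself
  is allowed as direction.\<close>

lemma distr_cov_deriv:
  fixes p
  assumes X: "X \<in> vfields A" and Y: "Y \<in> distr_sections A g \<xi>"
  defines "W \<equiv> cov_deriv_endo (distr_connection g \<xi> D) (J_endo A \<theta> \<xi> g) X Y p"
  shows "W \<in> contact_distr A g \<xi> p"
    and "Z \<in> distr_sections A g \<xi> \<Longrightarrow> g p W (Z p) = T p X Y Z"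
proof -
  note Y' = distr_sectionsD[OF Y]
  let ?u = "D X (\<theta> \<cdot> Y) p" and ?v = "D X Y p"
  let ?P = "\<lambda>v. v - g p v (\<xi> p) *\<^sub>t \<xi> p"
  have u: "?u \<in> tangent_space A p" and v: "?v \<in> tangent_space A p"
    using X Y' by (simp_all add: vfields_tangent D_vfields \<theta>_vfields)
  have P_tangent: "?P w \<in> tangent_space A p" if "w \<in> tangent_space A p" for w
    using that by (intro tangent_space_diff tangent_space_scale \<xi>_tangent)
  have P_distr: "?P w \<in> contact_distr A g \<xi> p" if "w \<in> tangent_space A p" for w
    using P_tangent[OF that] that
    by (simp add: contact_distr_def metric_diff_left metric_scale_left tangent_space_scale \<xi>_tangent \<xi>_unit)
  have J: "(J_endo A \<theta> \<xi> g \<cdot> V) q = \<theta> q (V q)" if "V q \<in> contact_distr A g \<xi> q" for V q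
    using that by (simp add: J_endo_def app_endo_def)
  \<comment> \<open>The restriction must agree with \<theta> along all of \<open>Y\<close>, since
    this field is differentiated next.\<close>
  then have JY: "J_endo A \<theta> \<xi> g \<cdot> Y = \<theta> \<cdot> Y"
    using Y'(4) by (intro ext) (simp add: app_endo_def[of \<theta>])
  have P: "distr_connection g \<xi> D X V p = ?P (D X V p)" for V
    by (simp add: distr_connection_def distr_proj_def app_endo_def fun_diff_def)
  have "\<theta> p (?P ?v) = \<theta> p ?v"
    using \<theta>_lincomb[OF v \<xi>_tangent, of 1 "- g p ?v (\<xi> p)"] by (simp add: \<theta>_\<xi>)
  then have W: "W = ?P ?u - \<theta> p ?v"
    using P_distr[OF v] J[of "distr_connection g \<xi> D X Y" p]
    by (simp add: W_def cov_deriv_endo_def JY P)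
  show "W \<in> contact_distr A g \<xi> p"
    using P_distr[OF u] \<theta>_orthogonal[OF v] \<theta>_tangent[OF v] \<xi>_tangent
    unfolding W by (simp add: contact_distr_def tangent_space_diff metric_diff_left)
  assume Z: "Z \<in> distr_sections A g \<xi>"
  note Z' = distr_sectionsD[OF Z]
  have "g p (\<xi> p) (Z p) = 0"
    using Z'(3)[of p] metric_sym[OF \<xi>_tangent Z'(2)] by simp
  then have "g p W (Z p) = g p ?u (Z p) - g p (\<theta> p ?v) (Z p)"
    unfolding W using u Z'(2)
    by (simp add: metric_diff_left metric_scale_left tangent_space_scale tangent_space_diff
        \<xi>_tangent \<theta>_tangent[OF v])
  then show "g p W (Z p) = T p X Y Z"
    using T_expand[OF X Y'(1) Z'(1)] \<theta>_skew[OF v Z'(2)] by simp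
qed

end

section \<open>Expansion in an orthonormal basis\<close>

lemma orthonormal_basis_expand:
  assumes "riemannian_manifold A g D"
    and "orthonormal_basis (g p) W I e" and "finite I"
    and "\<And>i. i \<in> I \<Longrightarrow> e i \<in> tangent_space A p" and "w \<in> W"
  shows "w = (\<Sum>i\<in>I. g p w (e i) *\<^sub>t e i)"
proof -
  interpret riemannian_manifold A g D by fact
  have on: "g p (e i) (e j) = (if i = j then 1 else 0)" if "i \<in> I" "j \<in> I" for i j
    using assms(2) that unfolding orthonormal_basis_def by blast
  \<comment> \<open>The span gives coefficients indexed by vectors; injectivity turns them into
    coefficients indexed by \<open>I\<close>.\<close>
  have inj: "inj_on e I"
    using on by (metis inj_onI zero_neq_one)
  have "w \<in> tvec.span (e ` I)"
    using assms(2,5) unfolding orthonormal_basis_def by simp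
  then obtain c where "w = (\<Sum>v\<in>e ` I. c v *\<^sub>t v)"
    using tvec.span_finite[of "e ` I"] assms(3) by auto
  then have w: "w = (\<Sum>i\<in>I. c (e i) *\<^sub>t e i)"
    by (simp add: sum.reindex[OF inj])
  have "g p w (e j) = c (e j)" if j: "j \<in> I" for j
  proof -
    have "g p w (e j) = (\<Sum>i\<in>I. c (e i) * g p (e i) (e j))"
      unfolding w using assms(4) j by (intro metric_sum_left) auto
    also have "\<dots> = (\<Sum>i\<in>I. if i = j then c (e i) else 0)"
      using on j by (intro sum.cong) auto
    finally show ?thesis using j assms(3) by simp
  qed
  then show ?thesis using w by simp
qed

section \<open>The double sum over a frame of the distribution\<close>

context nearly_cosymplectic_manifold
begin

text \<open>The fields are sections everywhere, so they can be differentiated, but they are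
  orthonormal only at \<open>p\<close>; every expansion below is therefore made at
  \<open>p\<close>.\<close>

lemma sum_curvature_commutator_zero:
  assumes fin: "finite I" and F: "\<And>i. i \<in> I \<Longrightarrow> F i \<in> distr_sections A g \<xi>"
    and on: "orthonormal_basis (g p) (contact_distr A g \<xi> p) I (\<lambda>i. F i p)"
  shows "(\<Sum>i\<in>I. \<Sum>j\<in>I. g p (curvature_commutator A D \<theta> (F i) \<xi> (F j) p)
    (cov_deriv_endo (distr_connection g \<xi> D) (J_endo A \<theta> \<xi> g) (F i) (F j) p)) = 0"
proof -
  have Fs: "F i \<in> vfields A" "F i q \<in> tangent_space A q" "g q (F i q) (\<xi> q) = 0" if "i \<in> I" for i q
    using distr_sectionsD[OF F[OF that]] by blast+
  define R where "R i j = curvature A D (F i) \<xi> (F j)" for i j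
  define \<rho> where "\<rho> i j k = g p (R i j p) (F k p)" for i j k
  define t where "t i j k = T p (F i) (F j) (F k)" for i j k
  define u where "u i j k = T p (F i) (\<theta> \<cdot> F j) (F k)" for i j k
  define a where "a j l = g p (\<theta> p (F j p)) (F l p)" for j l
  define W where "W i j = cov_deriv_endo (distr_connection g \<xi> D) (J_endo A \<theta> \<xi> g) (F i) (F j) p" for i j
  have R_vf: "R i j \<in> vfields A" if "i \<in> I" "j \<in> I" for i j
    unfolding R_def using that Fs \<xi>_vfields by (intro curvature_vfields) auto
  note expand = orthonormal_basis_expand[OF riemannian_manifold_axioms on fin Fs(2)]
  have a_skew: "a l j = - a j l" if "j \<in> I" "l \<in> I" for j l
    using \<theta>_skew[of "F l p" p "F j p"] metric_sym[of "F l p" p "\<theta> p (F j p)"] Fs(2) that \<theta>_tangent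
    by (simp add: a_def)
  \<comment> \<open>The image of \<theta> is orthogonal to \<xi>, so the basis of the distribution
    suffices and \<open>a\<close> is the matrix of \<theta> at \<open>p\<close>.\<close>
  have \<theta>F: "\<theta> p (F j p) = (\<Sum>l\<in>I. a j l *\<^sub>t F l p)" if "j \<in> I" for j
    unfolding a_def using that Fs(2) \<theta>_tangent \<theta>_orthogonal
    by (intro expand) (auto simp: contact_distr_def)
  have WF: "W i j = (\<Sum>k\<in>I. t i j k *\<^sub>t F k p)" if "i \<in> I" "j \<in> I" for i j
  proof -
    note W = distr_cov_deriv[OF Fs(1)[OF that(1)] F[OF that(2)], where p = p, folded W_def]
    show ?thesis using expand[OF _ W(1)] W(2)[OF F] by (simp add: t_def)
  qed
  have u_t: "u i j k = (\<Sum>l\<in>I. a k l * t i j l)" if "i \<in> I" "j \<in> I" "k \<in> I" for i j k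
  proof -
    have "u i j k = g p (cov_deriv_endo D \<theta> (F i) (F j) p) (\<theta> p (F k p))"
      using T_\<theta>[OF Fs(1) F F, of i j k p] that by (simp add: u_def T_def app_endo_def)
    also have "\<dots> = (\<Sum>l\<in>I. a k l * t i j l)"
      unfolding \<theta>F[OF that(3)] t_def T_def
      using that Fs vfields_tangent[OF \<theta>_cov_vfields[OF Fs(1) Fs(1)]] by (intro metric_sum_right) auto
    finally show ?thesis .
  qed
  have t_skew: "t i k j = - t i j k" if "i \<in> I" "j \<in> I" "k \<in> I" for i j k
    unfolding t_def using Fs(1) that by (intro T_skew23) auto
  have u_cyclic: "u j k i = u i j k" if "i \<in> I" "j \<in> I" "k \<in> I" for i j k
    unfolding u_def using F that by (intro T_\<theta>_cyclic) auto
  have \<rho>_cyclic: "\<rho> i j k + \<rho> j k i + \<rho> k i j = 0" if "i \<in> I" "j \<in> I" "k \<in> I" for i j k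
    unfolding \<rho>_def R_def using that Fs(1) \<xi>_vfields by (intro curvature_cyclic) auto
  \<comment> \<open>\<open>\<theta> \<cdot> F j\<close> is a combination of the \<open>F l\<close> only at \<open>p\<close>; skew symmetry moves it into
    the slot where only its value at \<open>p\<close> matters, so tensoriality of the curvature is not needed.\<close>
  have comm: "g p (curvature_commutator A D \<theta> (F i) \<xi> (F j) p) (F k p) =
      (\<Sum>l\<in>I. a k l * \<rho> i j l) - (\<Sum>l\<in>I. a j l * \<rho> i k l)" if "i \<in> I" "j \<in> I" "k \<in> I" for i j k
  proof -
    have "g p (curvature A D (F i) \<xi> (\<theta> \<cdot> F j) p) (F k p) = - g p (R i k p) (\<theta> p (F j p))"
      unfolding R_def using curvature_skew34[of "F i" \<xi> "\<theta> \<cdot> F j" "F k" p] that Fs(1) \<xi>_vfields \<theta>_vfields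
      by (simp add: app_endo_def)
    moreover have "g p (\<theta> p (R i j p)) (F k p) = - g p (R i j p) (\<theta> p (F k p))"
      using that Fs(2) vfields_tangent[OF R_vf] by (intro \<theta>_skew) auto
    \<comment> \<open>The indices are fresh because this is used for \<open>i j k\<close> and also
      for \<open>i k j\<close>.\<close>
    moreover have "g p (R i j p) (\<theta> p (F k p)) = (\<Sum>l\<in>I. a k l * \<rho> i j l)"
      if "i \<in> I" "j \<in> I" "k \<in> I" for i j k
      unfolding \<theta>F[OF that(3)] \<rho>_def
      using that Fs(2) vfields_tangent[OF R_vf] by (intro metric_sum_right) auto
    moreover have "g p (curvature_commutator A D \<theta> (F i) \<xi> (F j) p) (F k p) =
        g p (curvature A D (F i) \<xi> (\<theta> \<cdot> F j) p) (F k p) - g p (\<theta> p (R i j p)) (F k p)"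
      using that Fs R_vf \<xi>_vfields
      by (simp add: curvature_commutator_def R_def app_endo_def[of \<theta> "curvature A D _ _ _"]
          metric_diff_left vfields_tangent \<theta>_vfields curvature_vfields \<theta>_tangent)
    ultimately show ?thesis using that by simp
  qed
  have comm_tangent: "curvature_commutator A D \<theta> (F i) \<xi> (F j) p \<in> tangent_space A p"
    if "i \<in> I" "j \<in> I" for i j
    unfolding curvature_commutator_def using that Fs(1) \<xi>_vfields
    by (intro vfields_tangent vfields_diff curvature_vfields \<theta>_vfields) auto
  have entry: "g p (curvature_commutator A D \<theta> (F i) \<xi> (F j) p) (W i j) =
      (\<Sum>k\<in>I. \<Sum>l\<in>I. t i j k * a k l * \<rho> i j l) - (\<Sum>k\<in>I. \<Sum>l\<in>I. t i j k * a j l * \<rho> i k l)"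
    if "i \<in> I" "j \<in> I" for i j
  proof -
    have "g p (curvature_commutator A D \<theta> (F i) \<xi> (F j) p) (W i j) =
        (\<Sum>k\<in>I. t i j k * g p (curvature_commutator A D \<theta> (F i) \<xi> (F j) p) (F k p))"
      unfolding WF[OF that] using that comm_tangent Fs(2) by (intro metric_sum_right) auto
    also have "\<dots> = (\<Sum>k\<in>I. t i j k * ((\<Sum>l\<in>I. a k l * \<rho> i j l) - (\<Sum>l\<in>I. a j l * \<rho> i k l)))"
      using that comm by (intro sum.cong) auto
    finally show ?thesis
      by (simp add: right_diff_distrib sum_subtractf sum_distrib_left mult.assoc)
  qed
  \<comment> \<open>Contracting \<open>t\<close> with \<open>a\<close> over \<open>k\<close> puts
    \<theta> into the last slot, which is \<open>u\<close> by \<open>u_t\<close>; the sign comes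
    from \<open>a k l = - a l k\<close>.\<close>
  have row: "(\<Sum>k\<in>I. \<Sum>l\<in>I. t i j k * a k l * \<rho> i j l) = - (\<Sum>l\<in>I. \<rho> i j l * u i j l)"
    if "i \<in> I" "j \<in> I" for i j
  proof -
    have "(\<Sum>k\<in>I. \<Sum>l\<in>I. t i j k * a k l * \<rho> i j l) = (\<Sum>l\<in>I. \<Sum>k\<in>I. t i j k * a k l * \<rho> i j l)"
      by (rule sum.swap)
    also have "\<dots> = (\<Sum>l\<in>I. - (\<rho> i j l * u i j l))"
    proof (rule sum.cong[OF refl])
      fix l assume l: "l \<in> I"
      have "(\<Sum>k\<in>I. t i j k * a k l * \<rho> i j l) = (\<Sum>k\<in>I. - (\<rho> i j l * (a l k * t i j k)))"
        using a_skew[OF l] by (intro sum.cong) simp_all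
      then show "(\<Sum>k\<in>I. t i j k * a k l * \<rho> i j l) = - (\<rho> i j l * u i j l)"
        using u_t[OF that l] by (simp add: sum_negf sum_distrib_left)
    qed
    finally show ?thesis by (simp add: sum_negf)
  qed
  \<comment> \<open>Exchanging the names \<open>j\<close> and \<open>k\<close> and using that
    \<open>t\<close> is skew in them, the subtracted half of \<open>entry\<close> equals minus the
    first half, so the two add up to twice the first.\<close>
  have "(\<Sum>j\<in>I. \<Sum>k\<in>I. \<Sum>l\<in>I. t i j k * a j l * \<rho> i k l) =
      - (\<Sum>j\<in>I. \<Sum>k\<in>I. \<Sum>l\<in>I. t i j k * a k l * \<rho> i j l)" if i: "i \<in> I" for i
  proof -
    have "(\<Sum>j\<in>I. \<Sum>k\<in>I. \<Sum>l\<in>I. t i j k * a j l * \<rho> i k l) =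
        (\<Sum>j\<in>I. \<Sum>k\<in>I. \<Sum>l\<in>I. t i k j * a k l * \<rho> i j l)"
      by (rule sum.swap)
    also have "\<dots> = (\<Sum>j\<in>I. \<Sum>k\<in>I. \<Sum>l\<in>I. - (t i j k * a k l * \<rho> i j l))"
      by (intro sum.cong refl) (metis t_skew i mult_minus_left)
    finally show ?thesis by (simp add: sum_negf)
  qed
  then have "(\<Sum>i\<in>I. \<Sum>j\<in>I. g p (curvature_commutator A D \<theta> (F i) \<xi> (F j) p) (W i j)) =
      2 * (\<Sum>i\<in>I. \<Sum>j\<in>I. \<Sum>k\<in>I. \<Sum>l\<in>I. t i j k * a k l * \<rho> i j l)"
    by (simp add: entry sum_subtractf flip: sum_distrib_left)
  also have "\<dots> = - 2 * (\<Sum>i\<in>I. \<Sum>j\<in>I. \<Sum>l\<in>I. \<rho> i j l * u i j l)"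
    by (simp add: row sum_negf)
  also have "\<dots> = 0"
    by (simp only: sum_Bianchi_alternating[of I \<rho> u, OF \<rho>_cyclic u_cyclic] mult_zero_right)
  finally show ?thesis unfolding W_def .
qed

end

theorem proposition4p3:
  fixes A :: "('a::{t2_space,second_countable_topology}, 'm::finite) chart set"
    and \<theta> :: "'a endo" and \<xi> :: "'a vfield" and \<eta> :: "'a one_form" and g :: "'a bilinear_form"
    and nabla :: "'a connection"
    and n :: nat and p :: 'a and E F :: "nat \<Rightarrow> 'a vfield"
  assumes "smooth_atlas A" and "CARD('m) = 2 * n + 1"
    and "nearly_cosymplectic A \<theta> \<xi> \<eta> g nabla"
    and "\<forall>j\<in>{1..2*n}. F j \<in> distr_sections A g \<xi>"
    and "orthonormal_basis (g p) (contact_distr A g \<xi> p) {1..2*n} (\<lambda>j. F j p)"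
    and "\<forall>i\<in>{1..2*n}. E i = F i" and "E (2*n+1) = \<xi>"
  shows "(\<Sum>i=1..2*n+1. \<Sum>j=1..2*n.
           g p (curvature_commutator A nabla \<theta> (E i) \<xi> (F j) p)
               (cov_deriv_endo (distr_connection g \<xi> nabla) (J_endo A \<theta> \<xi> g) (E i) (F j) p)) = 0"
proof -
  interpret nearly_cosymplectic_manifold A g nabla \<theta> \<xi> \<eta>
    using assms(1,3)
    by unfold_locales (auto simp: nearly_cosymplectic_def almost_contact_metric_def)
  let ?c = "\<lambda>i j. g p (curvature_commutator A nabla \<theta> (E i) \<xi> (F j) p)
    (cov_deriv_endo (distr_connection g \<xi> nabla) (J_endo A \<theta> \<xi> g) (E i) (F j) p)"
  have "(\<Sum>i=1..2*n. \<Sum>j=1..2*n. ?c i j) = 0"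
    using sum_curvature_commutator_zero[of "{1..2*n}" F p] assms(4-6) by simp
  \<comment> \<open>The last index stands for \<xi>, where the commutator contains the curvature of
    \<xi> with itself. Its partner still has to be shown tangent, since \<open>g\<close> is
    constrained only on tangent vectors.\<close>
  moreover have "?c (2*n+1) j = 0" if j: "j \<in> {1..2*n}" for j
  proof -
    have Fj: "F j \<in> distr_sections A g \<xi>" using assms(4) j by blast
    have "\<theta> p 0 = 0" using \<theta>_lincomb[OF \<xi>_tangent \<xi>_tangent, of p 0 0] by simp
    then have "curvature_commutator A nabla \<theta> \<xi> \<xi> (F j) p = 0"
      using distr_sectionsD(1)[OF Fj] \<xi>_vfields \<theta>_vfields
      by (simp add: curvature_commutator_def curvature_self app_endo_def)
    moreover have "cov_deriv_endo (distr_connection g \<xi> nabla) (J_endo A \<theta> \<xi> g) \<xi> (F j) p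
        \<in> tangent_space A p"
      using distr_cov_deriv(1)[OF \<xi>_vfields Fj] by (simp add: contact_distr_def)
    ultimately show ?thesis using assms(7) metric_zero_left by simp
  qed
  ultimately show ?thesis by simp
qed

end
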